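(* Let $T_1,T_2\in\mathcal{B}_A(\mathcal{H})$. Then $$w_{\mathbb{A}}\left(\begin{bmatrix}T_1&T_2\\O&O\end{bmatrix}\right)\ge\frac12\max\{w_A(T_1+iT_2),\,w_A(T_1-iT_2)\}.$$
   Context: $\mathcal{H}$ is a complex Hilbert space with inner product $\langle\cdot,\cdot\rangle$, $\mathcal{B}(\mathcal{H})$ is the algebra of bounded linear operators on $\mathcal{H}$, and $A\in\mathcal{B}(\mathcal{H})$ is a positive operator, i.e. $A$ is selfadjoint and $\langle Ax,x\rangle\ge 0$ for all $x$. Put $\langle x,y\rangle_A=\langle Ax,y\rangle$ and $\|x\|_A=\sqrt{\langle x,x\rangle_A}$. $\mathcal{R}(\cdot)$ denotes range, and $\mathcal{B}_A(\mathcal{H})=\{T\in\mathcal{B}(\mathcal{H}):\mathcal{R}(T^*A)\subseteq\mathcal{R}(A)\}$ (the operators admitting an $A$-adjoint, i.e. some $X\in\mathcal{B}(\mathcal{H})$ with $AX=T^*A$). The $A$-numerical radius is $w_A(T)=\sup\{|\langle Tx,x\rangle_A|:x\in\mathcal{H},\ \|x\|_A=1\}$. $\mathbb{A}=\mathrm{diag}(A,A)$ is the positive operator on $\mathcal{H}\oplus\mathcal{H}$ with diagonal entries $A$, and $w_{\mathbb{A}}$ is defined in the same way with $\mathcal{H}\oplus\mathcal{H}$ and $\mathbb{A}$ in place of $\mathcal{H}$ and $A$. $O$ is the null operator on $\mathcal{H}$. *)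

theory Defs
  imports "HOL-Analysis.Analysis"
begin

section \<open>Complex Hilbert spaces\<close>

text \<open>The inner product is linear in the first and conjugate-linear in the second argument.\<close>

class complex_inner = real_normed_vector +
  fixes scaleC :: "complex \<Rightarrow> 'a \<Rightarrow> 'a"  (infixr "*\<^sub>C" 75)
    and cinner :: "'a \<Rightarrow> 'a \<Rightarrow> complex"
  assumes scaleC_add_right: "c *\<^sub>C (x + y) = c *\<^sub>C x + c *\<^sub>C y"
    and scaleC_add_left: "(c + d) *\<^sub>C x = c *\<^sub>C x + d *\<^sub>C x"
    and scaleC_scaleC: "c *\<^sub>C d *\<^sub>C x = (c * d) *\<^sub>C x"
    and scaleR_scaleC: "r *\<^sub>R x = complex_of_real r *\<^sub>C x"
    and cinner_commute: "cinner x y = cnj (cinner y x)"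
    and cinner_add_left: "cinner (x + y) z = cinner x z + cinner y z"
    and cinner_scaleC_left: "cinner (c *\<^sub>C x) y = c * cinner x y"
    and cinner_ge_zero: "0 \<le> Re (cinner x x)"
    and cinner_eq_zero_iff: "cinner x x = 0 \<longleftrightarrow> x = 0"
    and norm_eq_sqrt_cinner: "norm x = sqrt (Re (cinner x x))"

class complex_hilbert = complex_inner + complete_space

text \<open>The Hilbert space direct sum; its norm is the one HOL-Analysis puts on products.\<close>

instantiation prod :: (complex_inner, complex_inner) complex_inner
begin

definition scaleC_prod_def: "scaleC c p = (c *\<^sub>C fst p, c *\<^sub>C snd p)"

definition cinner_prod_def: "cinner p q = cinner (fst p) (fst q) + cinner (snd p) (snd q)"

instance
proof
  fix c d :: complex and r :: real and x y z :: "'a \<times> 'b"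
  show "c *\<^sub>C (x + y) = c *\<^sub>C x + c *\<^sub>C y" "(c + d) *\<^sub>C x = c *\<^sub>C x + d *\<^sub>C x"
    "c *\<^sub>C d *\<^sub>C x = (c * d) *\<^sub>C x" "r *\<^sub>R x = complex_of_real r *\<^sub>C x"
    by (simp_all add: scaleC_prod_def scaleC_add_right scaleC_add_left scaleC_scaleC
        scaleR_scaleC prod_eq_iff)
  show "cinner x y = cnj (cinner y x)"
    by (simp add: cinner_prod_def cinner_commute[symmetric])
  show "cinner (x + y) z = cinner x z + cinner y z" "cinner (c *\<^sub>C x) y = c * cinner x y"
    by (simp_all add: cinner_prod_def scaleC_prod_def cinner_add_left cinner_scaleC_left
        algebra_simps)
  show ge: "0 \<le> Re (cinner x x)"
    by (simp add: cinner_prod_def cinner_ge_zero)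
  show "norm x = sqrt (Re (cinner x x))"
    by (simp add: cinner_prod_def norm_prod_def norm_eq_sqrt_cinner cinner_ge_zero)
  have im: "Im (cinner u u) = 0" for u :: "'c::complex_inner"
    using cinner_commute[of u u] by (metis Reals_cnj_iff complex_is_Real_iff)
  show "cinner x x = 0 \<longleftrightarrow> x = 0"
  proof
    assume "cinner x x = 0"
    then have "Re (cinner (fst x) (fst x)) + Re (cinner (snd x) (snd x)) = 0"
      by (metis cinner_prod_def plus_complex.sel(1) zero_complex.sel(1))
    then have "Re (cinner (fst x) (fst x)) = 0" "Re (cinner (snd x) (snd x)) = 0"
      using cinner_ge_zero[of "fst x"] cinner_ge_zero[of "snd x"] by linarith+
    then have "cinner (fst x) (fst x) = 0" "cinner (snd x) (snd x) = 0"
      by (simp_all add: complex_eq_iff im)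
    then show "x = 0" by (simp add: cinner_eq_zero_iff prod_eq_iff)
  next
    have "cinner (0::'a) 0 = 0" "cinner (0::'b) 0 = 0"
      by (simp_all add: cinner_eq_zero_iff)
    then show "x = 0 \<Longrightarrow> cinner x x = 0"
      by (simp add: cinner_prod_def)
  qed
qed

end

instance prod :: (complex_hilbert, complex_hilbert) complex_hilbert ..

section \<open>Bounded operators and the adjoint\<close>

definition bounded_clinear :: "('a::complex_inner \<Rightarrow> 'b::complex_inner) \<Rightarrow> bool" where
  "bounded_clinear T \<longleftrightarrow> bounded_linear T \<and> (\<forall>c x. T (c *\<^sub>C x) = c *\<^sub>C T x)"

definition cadjoint :: "('a::complex_hilbert \<Rightarrow> 'a) \<Rightarrow> 'a \<Rightarrow> 'a" where
  "cadjoint T = (THE S. \<forall>x y. cinner (T x) y = cinner x (S y))"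

lemma cinner_add_right: "cinner x (y + z) = cinner x y + cinner x z"
  for x y z :: "'a::complex_inner"
  by (metis cinner_add_left cinner_commute complex_cnj_add)

lemma cinner_scaleC_right: "cinner x (c *\<^sub>C y) = cnj c * cinner x y"
  for x y :: "'a::complex_inner"
  by (metis cinner_scaleC_left cinner_commute complex_cnj_mult)

lemma cinner_scaleR_left: "cinner (r *\<^sub>R x) y = of_real r * cinner x y"
  for x y :: "'a::complex_inner"
  by (simp add: scaleR_scaleC cinner_scaleC_left)

lemma cinner_scaleR_right: "cinner x (r *\<^sub>R y) = of_real r * cinner x y"
  for x y :: "'a::complex_inner"
  by (simp add: scaleR_scaleC cinner_scaleC_right)

lemma cinner_minus_right: "cinner x (y - z) = cinner x y - cinner x z"
  for x y z :: "'a::complex_inner"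
  by (metis add_diff_cancel cinner_add_right diff_add_cancel)

lemma norm_sq_cinner: "(norm x)\<^sup>2 = Re (cinner x x)"
  for x :: "'a::complex_inner"
  by (simp add: norm_eq_sqrt_cinner cinner_ge_zero)

lemma norm_add_sq: "(norm (x + y))\<^sup>2 = (norm x)\<^sup>2 + 2 * Re (cinner x y) + (norm y)\<^sup>2"
  for x y :: "'a::complex_inner"
proof -
  have "Re (cinner y x) = Re (cinner x y)"
    using cinner_commute[of y x] by simp
  then show ?thesis
    by (simp add: norm_sq_cinner cinner_add_left cinner_add_right)
qed

lemma Re_cinner_le: "Re (cinner x y) \<le> norm x * norm y"
  for x y :: "'a::complex_inner"
proof -
  have "(norm (x + y))\<^sup>2 \<le> (norm x + norm y)\<^sup>2"
    by (simp add: norm_triangle_ineq power_mono)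
  then show ?thesis by (simp add: norm_add_sq power2_sum)
qed

lemma Re_cinner_abs_le: "\<bar>Re (cinner x y)\<bar> \<le> norm x * norm y"
  for x y :: "'a::complex_inner"
proof -
  have "cinner (- x) y = - cinner x y"
    using cinner_scaleR_left[of "-1" x y] by simp
  then show ?thesis
    using Re_cinner_le[of x y] Re_cinner_le[of "- x" y] by simp
qed

lemma norm_parallelogram:
  "(norm (x - y))\<^sup>2 = 2 * (norm x)\<^sup>2 + 2 * (norm y)\<^sup>2 - (norm (x + y))\<^sup>2"
  for x y :: "'a::complex_inner"
proof -
  have "cinner x (- y) = - cinner x y"
    using cinner_scaleR_right[of x "-1" y] by simp
  then show ?thesis
    using norm_add_sq[of x y] norm_add_sq[of x "- y"] by simp
qed

text \<open>The Riesz representation theorem, by minimising the quadratic functional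
  \<open>(norm x)\<^sup>2 - 2 * f x\<close>.\<close>

lemma riesz_real:
  fixes f :: "'a::complex_hilbert \<Rightarrow> real"
  assumes f: "bounded_linear f"
  shows "\<exists>t. \<forall>x. f x = Re (cinner x t)"
proof -
  interpret f: bounded_linear f by (rule f)
  define Q where "Q x = (norm x)\<^sup>2 - 2 * f x" for x
  obtain K where K: "\<And>x. norm (f x) \<le> norm x * K"
    using f.bounded by blast
  have lb: "- (K\<^sup>2) \<le> Q x" for x
  proof -
    have "f x \<le> norm x * K" using K[of x] by simp
    moreover have "0 \<le> (norm x - K)\<^sup>2" by simp
    ultimately show ?thesis by (simp add: Q_def power2_diff)
  qed
  define m where "m = (INF x. Q x)"
  have bdd: "bdd_below (range Q)"
    using lb by (auto intro!: bdd_belowI)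
  have m_le: "m \<le> Q x" for x
    unfolding m_def by (rule cINF_lower[OF bdd]) simp
  have "\<exists>x. Q x < m + 1 / real (Suc n)" for n
  proof -
    have "m < m + 1 / real (Suc n)" by simp
    then show ?thesis
      using cINF_less_iff[OF UNIV_not_empty bdd, of "m + 1 / real (Suc n)"]
      unfolding m_def by blast
  qed
  then obtain X where X: "\<And>n. Q (X n) < m + 1 / real (Suc n)"
    by metis
  have par: "(norm (x - y))\<^sup>2 \<le> 2 * Q x + 2 * Q y - 4 * m" for x y
  proof -
    have "Q ((1/2) *\<^sub>R (x + y)) = (1/4) * (norm (x + y))\<^sup>2 - f x - f y"
      by (simp add: Q_def f.scaleR f.add power_divide add_divide_distrib del: scaleR_add_right)
    then have "m \<le> (1/4) * (norm (x + y))\<^sup>2 - f x - f y"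
      using m_le[of "(1/2) *\<^sub>R (x + y)"] by simp
    then show ?thesis
      by (simp add: norm_parallelogram Q_def)
  qed
  have "Cauchy X"
  proof (rule metric_CauchyI)
    fix e :: real
    assume e: "0 < e"
    obtain N where N: "4 / e\<^sup>2 < real N" using reals_Archimedean2 by blast
    show "\<exists>M. \<forall>p\<ge>M. \<forall>q\<ge>M. dist (X p) (X q) < e"
    proof (intro exI allI impI)
      fix p q assume pq: "N \<le> p" "N \<le> q"
      have small: "Q (X k) < m + e\<^sup>2 / 4" if "N \<le> k" for k
      proof -
        have "4 / e\<^sup>2 < real (Suc k)" using N that by simp
        then have "1 / real (Suc k) < e\<^sup>2 / 4"
          using e by (simp add: field_simps)
        then show ?thesis using X[of k] by simp
      qed
      have "(norm (X p - X q))\<^sup>2 < e\<^sup>2"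
        using par[of "X p" "X q"] small[OF pq(1)] small[OF pq(2)] by simp
      then show "dist (X p) (X q) < e"
        using e by (simp add: dist_norm power_less_imp_less_base)
    qed
  qed
  then obtain t where t: "X \<longlonglongrightarrow> t"
    using Cauchy_convergent convergent_def by blast
  have "(\<lambda>n. Q (X n)) \<longlonglongrightarrow> Q t"
    unfolding Q_def by (intro tendsto_intros f.tendsto t)
  moreover have "(\<lambda>n. m + 1 / real (Suc n)) \<longlonglongrightarrow> m + 0"
    by (intro tendsto_intros LIMSEQ_Suc[OF lim_1_over_n])
  ultimately have "Q t \<le> m + 0"
    by (rule LIMSEQ_le) (use X less_imp_le in blast)
  then have min: "Q t \<le> Q x" for x
    using m_le[of x] by linarith
  have "f x = Re (cinner x t)" for x
  proof (rule ccontr)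
    assume neq: "f x \<noteq> Re (cinner x t)"
    define d where "d = f x - Re (cinner x t)"
    have comm: "Re (cinner t x) = Re (cinner x t)"
      using cinner_commute[of t x] by simp
    have var: "2 * s * d \<le> s\<^sup>2 * (norm x)\<^sup>2" for s :: real
      using min[of "t + s *\<^sub>R x"]
      by (simp add: Q_def norm_add_sq f.add f.scaleR cinner_scaleR_right comm d_def
          power_mult_distrib algebra_simps)
    have d0: "d\<^sup>2 > 0" using neq by (simp add: d_def)
    define n where "n = (norm x)\<^sup>2 + 1"
    have n: "n > 0" "(norm x)\<^sup>2 \<le> n" by (simp_all add: n_def add_nonneg_pos)
    have "2 * (d / n) * d \<le> (d / n)\<^sup>2 * (norm x)\<^sup>2" by (rule var)
    also have "\<dots> \<le> (d / n)\<^sup>2 * n" using n by (intro mult_left_mono) auto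
    finally have "2 * (d\<^sup>2 / n) \<le> d\<^sup>2 / n"
      using n by (simp add: power2_eq_square)
    moreover have "d\<^sup>2 / n > 0" using d0 n by simp
    ultimately show False by simp
  qed
  then show ?thesis by blast
qed

lemma cinner_ext:
  fixes u v :: "'a::complex_inner"
  assumes "\<And>x. cinner x u = cinner x v"
  shows "u = v"
proof -
  have "cinner (u - v) (u - v) = 0" by (simp add: cinner_minus_right assms)
  then show ?thesis by (simp add: cinner_eq_zero_iff)
qed

lemma cinner_cadjoint:
  assumes T: "bounded_clinear T"
  shows "cinner (T x) y = cinner x (cadjoint T y)"
proof -
  interpret T: bounded_linear T using T by (simp add: bounded_clinear_def)
  have Tc: "T (c *\<^sub>C z) = c *\<^sub>C T z" for c z using T by (simp add: bounded_clinear_def)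
  have "\<exists>t. \<forall>x. cinner (T x) y = cinner x t" for y
  proof -
    obtain K where K: "\<And>x. norm (T x) \<le> norm x * K"
      using T.bounded by blast
    have "bounded_linear (\<lambda>x. Re (cinner (T x) y))"
    proof (rule bounded_linear_intro)
      show "norm (Re (cinner (T x) y)) \<le> norm x * (K * norm y)" for x
        using Re_cinner_abs_le[of "T x" y] mult_right_mono[OF K[of x] norm_ge_zero[of y]]
        by (simp add: mult.assoc)
    qed (simp_all add: T.add T.scaleR cinner_add_left cinner_scaleR_left)
    then obtain t where t: "\<And>x. Re (cinner (T x) y) = Re (cinner x t)"
      using riesz_real by blast
    have "cinner (T x) y = cinner x t" for x
      using t[of x] t[of "\<i> *\<^sub>C x"] by (simp add: Tc cinner_scaleC_left complex_eq_iff)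
    then show ?thesis by blast
  qed
  then obtain S where S: "\<forall>x y. cinner (T x) y = cinner x (S y)" by metis
  have "cadjoint T = S"
    unfolding cadjoint_def
  proof (rule the_equality)
    show "\<forall>x y. cinner (T x) y = cinner x (S y)" by (rule S)
  next
    fix S' assume "\<forall>x y. cinner (T x) y = cinner x (S' y)"
    then show "S' = S" using S by (intro ext cinner_ext) metis
  qed
  then show ?thesis using S by simp
qed

definition positive_op :: "('a::complex_hilbert \<Rightarrow> 'a) \<Rightarrow> bool" where
  "positive_op A \<longleftrightarrow>
     bounded_clinear A \<and> cadjoint A = A \<and> (\<forall>x. cinner (A x) x \<in> \<real>\<^sub>\<ge>\<^sub>0)"

definition block_op ::
  "('a \<Rightarrow> 'a) \<Rightarrow> ('a \<Rightarrow> 'a) \<Rightarrow> ('a \<Rightarrow> 'a) \<Rightarrow> ('a \<Rightarrow> 'a) \<Rightarrow> 'a \<times> 'a \<Rightarrow> 'a::complex_hilbert \<times> 'a"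
  where "block_op T11 T12 T21 T22 = (\<lambda>(x, y). (T11 x + T12 y, T21 x + T22 y))"

section \<open>The semi-inner product induced by a positive operator\<close>

definition A_inner :: "('a::complex_hilbert \<Rightarrow> 'a) \<Rightarrow> 'a \<Rightarrow> 'a \<Rightarrow> complex" where
  "A_inner A x y = cinner (A x) y"

definition A_norm :: "('a::complex_hilbert \<Rightarrow> 'a) \<Rightarrow> 'a \<Rightarrow> real" where
  "A_norm A x = sqrt (Re (A_inner A x x))"

definition A_adjointable :: "('a::complex_hilbert \<Rightarrow> 'a) \<Rightarrow> ('a \<Rightarrow> 'a) set" where
  "A_adjointable A = {T. bounded_clinear T \<and> range (cadjoint T \<circ> A) \<subseteq> range A}"

text \<open>The supremum is taken in \<open>[0, \<infinity>]\<close>: for a general bounded \<open>T\<close> it may be infinite, and it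
  is \<open>0\<close> in the degenerate case \<open>A = 0\<close>, where no vector has \<open>A\<close>-norm \<open>1\<close>.\<close>

definition A_numerical_radius :: "('a::complex_hilbert \<Rightarrow> 'a) \<Rightarrow> ('a \<Rightarrow> 'a) \<Rightarrow> ennreal" where
  "A_numerical_radius A T =
     (SUP x \<in> {x. A_norm A x = 1}. ennreal (cmod (A_inner A (T x) x)))"

end

theory Submission
  imports Defs
begin

text \<open>
  The idea is to test the block operator on vectors spread evenly over the two copies of the
  space. If \<open>x\<close> is an \<open>A\<close>-unit vector and \<open>c\<close> is a unimodular scalar, then
  \<open>z = (x / \<surd>2, c x / \<surd>2)\<close> is a unit vector for \<open>diag(A, A)\<close>, and since the second row of the
  block operator vanishes, only the first coordinate of \<open>z\<close> is paired with its image: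
  \<open>\<langle>diag(A, A) B z, z\<rangle> = 1/2 \<langle>A (T1 + c T2) x, x\<rangle>\<close>, where \<open>B\<close> is the block operator.
  So every value of the \<open>A\<close>-numerical range of \<open>T1 + c T2\<close>, halved, is a value of the numerical
  range of the block operator, which is the lemma \<open>radius_combination_le_radius_row_block\<close>.
  The theorem is the pair of cases \<open>c = \<i>\<close> and \<open>c = - \<i>\<close>.
\<close>

lemma A_inner_block_diag:
  "A_inner (block_op A (\<lambda>_. 0) (\<lambda>_. 0) A) p q = A_inner A (fst p) (fst q) + A_inner A (snd p) (snd q)"
  by (simp add: A_inner_def block_op_def cinner_prod_def case_prod_beta)

lemma A_inner_scaleC_left:
  assumes "bounded_clinear A"
  shows "A_inner A (c *\<^sub>C x) y = c * A_inner A x y"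
  using assms by (simp add: A_inner_def bounded_clinear_def cinner_scaleC_left)

lemma A_inner_scaleC_right: "A_inner A x (c *\<^sub>C y) = cnj c * A_inner A x y"
  by (simp add: A_inner_def cinner_scaleC_right)

lemma A_inner_zero_left:
  assumes "bounded_clinear A"
  shows "A_inner A 0 y = 0"
proof -
  have "0 *\<^sub>C (0::'a) = 0"
    using scaleR_scaleC[of 0 "0::'a"] by simp
  then show ?thesis
    using A_inner_scaleC_left[OF assms, of 0 0 y] by simp
qed

lemma of_real_square_half:
  assumes "r\<^sup>2 = 1 / 2"
  shows "complex_of_real r * of_real r = 1 / 2"
proof -
  have "complex_of_real (r * r) = of_real (1 / 2)"
    using assms by (simp only: power2_eq_square)
  then show ?thesis
    by simp
qed

text \<open>The two coordinates share the weight \<open>1 / 2\<close> equally, whatever the phase \<open>c\<close>.\<close>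

lemma A_norm_spread_vector:
  assumes A: "bounded_clinear A" and c: "cmod c = 1" and r: "r\<^sup>2 = 1 / 2"
  shows "A_norm (block_op A (\<lambda>_. 0) (\<lambda>_. 0) A) (of_real r *\<^sub>C x, (of_real r * c) *\<^sub>C x) = A_norm A x"
proof -
  have rr: "complex_of_real r * of_real r = 1 / 2"
    using of_real_square_half[OF r] .
  have cc: "c * cnj c = 1"
    using c by (simp flip: complex_norm_square)
  have "(of_real r * c) * cnj (of_real r * c) = (of_real r * of_real r) * (c * cnj c)"
    by simp
  also have "\<dots> = 1 / 2"
    by (simp only: rr cc) simp
  finally have rc: "(of_real r * c) * cnj (of_real r * c) = 1 / 2" .
  have scaled: "A_inner A (d *\<^sub>C x) (d *\<^sub>C x) = (d * cnj d) * A_inner A x x" for d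
    by (simp add: A_inner_scaleC_left[OF A] A_inner_scaleC_right)
  have "A_inner A (of_real r *\<^sub>C x) (of_real r *\<^sub>C x)
      + A_inner A ((of_real r * c) *\<^sub>C x) ((of_real r * c) *\<^sub>C x) = A_inner A x x"
    unfolding scaled rc complex_cnj_complex_of_real rr by simp
  then show ?thesis
    by (simp add: A_norm_def A_inner_block_diag)
qed

lemma A_inner_row_block_spread_vector:
  assumes A: "bounded_clinear A" and T1: "bounded_clinear T1" and T2: "bounded_clinear T2"
    and r: "r\<^sup>2 = 1 / 2"
  shows "A_inner (block_op A (\<lambda>_. 0) (\<lambda>_. 0) A)
      (block_op T1 T2 (\<lambda>_. 0) (\<lambda>_. 0) (of_real r *\<^sub>C x, (of_real r * c) *\<^sub>C x))
      (of_real r *\<^sub>C x, (of_real r * c) *\<^sub>C x)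
    = 1 / 2 * A_inner A (T1 x + c *\<^sub>C T2 x) x"
proof -
  have rr: "complex_of_real r * of_real r = 1 / 2"
    using of_real_square_half[OF r] .
  have image: "block_op T1 T2 (\<lambda>_. 0) (\<lambda>_. 0) (of_real r *\<^sub>C x, (of_real r * c) *\<^sub>C x)
      = (of_real r *\<^sub>C (T1 x + c *\<^sub>C T2 x), 0)"
    using T1 T2 by (simp add: block_op_def bounded_clinear_def scaleC_add_right scaleC_scaleC)
  have "A_inner A (of_real r *\<^sub>C (T1 x + c *\<^sub>C T2 x)) (of_real r *\<^sub>C x)
      = (of_real r * of_real r) * A_inner A (T1 x + c *\<^sub>C T2 x) x"
    by (simp add: A_inner_scaleC_left[OF A] A_inner_scaleC_right)
  then show ?thesis
    by (simp only: image A_inner_block_diag fst_conv snd_conv rr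
        A_inner_zero_left[OF A] add_0_right)
qed

lemma radius_combination_le_radius_row_block:
  assumes A: "bounded_clinear A" and T1: "bounded_clinear T1" and T2: "bounded_clinear T2"
    and c: "cmod c = 1"
  shows "1 / 2 * A_numerical_radius A (\<lambda>x. T1 x + c *\<^sub>C T2 x)
    \<le> A_numerical_radius (block_op A (\<lambda>_. 0) (\<lambda>_. 0) A) (block_op T1 T2 (\<lambda>_. 0) (\<lambda>_. 0))"
    (is "_ \<le> A_numerical_radius ?AA ?B")
proof -
  define r :: real where "r = sqrt (1 / 2)"
  have r: "r\<^sup>2 = 1 / 2"
    by (simp add: r_def)
  have "1 / 2 * ennreal (cmod (A_inner A (T1 x + c *\<^sub>C T2 x) x)) \<le> A_numerical_radius ?AA ?B"
    if x: "A_norm A x = 1" for x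
  proof -
    define z where "z = (of_real r *\<^sub>C x, (of_real r * c) *\<^sub>C x)"
    have "A_norm ?AA z = 1"
      unfolding z_def using A_norm_spread_vector[OF A c r] x by simp
    then have "ennreal (cmod (A_inner ?AA (?B z) z)) \<le> A_numerical_radius ?AA ?B"
      unfolding A_numerical_radius_def by (intro SUP_upper) simp
    moreover have "ennreal (cmod (A_inner ?AA (?B z) z))
        = 1 / 2 * ennreal (cmod (A_inner A (T1 x + c *\<^sub>C T2 x) x))"
    proof -
      have half: "(1 / 2 :: ennreal) = ennreal (1 / 2)"
        using divide_ennreal[of 1 2] by simp
      show ?thesis
        unfolding z_def A_inner_row_block_spread_vector[OF A T1 T2 r] half
        by (subst ennreal_mult[symmetric]) (simp_all add: norm_mult norm_divide)
    qed
    ultimately show ?thesis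
      by simp
  qed
  then show ?thesis
    unfolding A_numerical_radius_def[of A] SUP_mult_left_ennreal
    by (intro SUP_least) simp
qed

theorem theorem3p11:
  fixes A T1 T2 :: "'a::complex_hilbert \<Rightarrow> 'a"
  assumes "positive_op A"
    and "T1 \<in> A_adjointable A"
    and "T2 \<in> A_adjointable A"
  shows "A_numerical_radius (block_op A (\<lambda>_. 0) (\<lambda>_. 0) A) (block_op T1 T2 (\<lambda>_. 0) (\<lambda>_. 0))
    \<ge> 1 / 2 * max (A_numerical_radius A (\<lambda>x. T1 x + \<i> *\<^sub>C T2 x))
                   (A_numerical_radius A (\<lambda>x. T1 x - \<i> *\<^sub>C T2 x))"
proof -
  have A: "bounded_clinear A" and T1: "bounded_clinear T1" and T2: "bounded_clinear T2"
    using assms by (simp_all add: positive_op_def A_adjointable_def)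
  have minus: "(- \<i>) *\<^sub>C u = - (\<i> *\<^sub>C u)" for u :: 'a
    using scaleR_scaleC[of "- 1" "\<i> *\<^sub>C u"] by (simp add: scaleC_scaleC)
  have "1 / 2 * A_numerical_radius A (\<lambda>x. T1 x - \<i> *\<^sub>C T2 x)
      \<le> A_numerical_radius (block_op A (\<lambda>_. 0) (\<lambda>_. 0) A) (block_op T1 T2 (\<lambda>_. 0) (\<lambda>_. 0))"
    using radius_combination_le_radius_row_block[OF A T1 T2, of "- \<i>"] by (simp add: minus)
  then show ?thesis
    using radius_combination_le_radius_row_block[OF A T1 T2, of \<i>]
    by (simp add: max_def)
qed

end
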